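(* For $\alpha\in\mathbb{R}$ consider the linear system with switched delays with $$A=\begin{pmatrix}\cos\alpha&-\sin\alpha\\ \sin\alpha&\cos\alpha\end{pmatrix},\qquad B=\begin{pmatrix}1\\0\end{pmatrix},\qquad D=\{0,1\},$$ with a delay-independent controller. There are values of $\alpha$ such that, if the system is stabilized with a linear controller, one cannot guarantee the existence of a constant $K$ such that $\|x(t)\|\le K\rho^t$ for any $\rho<0.755\dots$. However, there is a nonlinear controller that allows such a guarantee with $\rho=0.69\dots$.
   Context: The system is $x(t+1)=Ax(t)+B\sum_{0\le t'\le t:\ t'+\sigma(t')=t}v(t')$, with $x(t)\in\mathbb{R}^2$, $v(t)\in\mathbb{R}$ and $\sigma:\mathbb{N}\to\{0,1\}$ an arbitrary switching signal; thus the control $v(t)$ emitted at time $t$ is applied either at time $t$ or at time $t+1$. The guarantee must hold whatever the switching signal is. A delay-independent controller does not have access to past, current or future values of $\sigma$, but it measures the state and keeps memory of its past outputs. A linear delay-independent controller is a static law $v(t)=\mathcal{K}\,(x(t),v(t-d_{\max}),\dots,v(t-1))$ with a fixed gain $\mathcal{K}\in\mathbb{R}^{m\times(n+md_{\max})}$, where $n$ is the state dimension, $m$ the input dimension and $d_{\max}$ the maximum delay; here $n=2$, $m=1$, $d_{\max}=1$, so $v(t)=\mathcal{K}\,(x(t),v(t-1))$ with $\mathcal{K}\in\mathbb{R}^{1\times3}$. A nonlinear controller is one whose output need not be a linear function of the information available to it. The number $0.755\dots$ is the positive root of $\rho^2+\rho^3=1$ (about $0.7549$), and $0.69\dots$ is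 a number whose decimal expansion begins with $0.69$. *)

theory Defs
  imports "HOL-Analysis.Analysis"
begin

type_synonym signal = "nat \<Rightarrow> nat"

text \<open>
  A static delay-independent law for maximum delay 1: it maps the current state
  and the previously emitted control to the control emitted now. In particular
  it does not see the switching signal.
\<close>

type_synonym controller = "real^2 \<Rightarrow> real \<Rightarrow> real"

definition switching_signal :: "nat set \<Rightarrow> signal \<Rightarrow> bool" where
  "switching_signal D \<sigma> \<longleftrightarrow> (\<forall>t. \<sigma> t \<in> D)"

definition applied_control :: "signal \<Rightarrow> (nat \<Rightarrow> real) \<Rightarrow> nat \<Rightarrow> real" where
  "applied_control \<sigma> v t = (\<Sum>t' | t' \<le> t \<and> t' + \<sigma> t' = t. v t')"

text \<open>
  No control is emitted before time 0, so the controller's memory of the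
  previous output is 0 at time 0.
\<close>

definition closed_loop ::
  "real^2^2 \<Rightarrow> real^2 \<Rightarrow> controller \<Rightarrow> signal \<Rightarrow> (nat \<Rightarrow> real^2) \<Rightarrow> (nat \<Rightarrow> real) \<Rightarrow> bool" where
  "closed_loop A B f \<sigma> x v \<longleftrightarrow>
     (\<forall>t. x (t + 1) = A *v x t + applied_control \<sigma> v t *\<^sub>R B) \<and>
     (\<forall>t. v t = f (x t) (if t = 0 then 0 else v (t - 1)))"

text \<open>
  The constant may depend on the initial state (take t = 0 in the bound),
  but not on the unknown switching signal.
\<close>

definition guarantees_rate ::
  "real^2^2 \<Rightarrow> real^2 \<Rightarrow> nat set \<Rightarrow> controller \<Rightarrow> real \<Rightarrow> bool" where
  "guarantees_rate A B D f \<rho> \<longleftrightarrow>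
     (\<forall>x0. \<exists>K. \<forall>\<sigma> x v. switching_signal D \<sigma> \<longrightarrow> closed_loop A B f \<sigma> x v \<longrightarrow> x 0 = x0 \<longrightarrow>
        (\<forall>t. norm (x t) \<le> K * \<rho> ^ t))"

definition linear_controller :: "real^3^1 \<Rightarrow> controller" where
  "linear_controller G = (\<lambda>x w. (G *v vector [x $ 1, x $ 2, w]) $ 1)"

definition planar_rotation :: "real \<Rightarrow> real^2^2" where
  "planar_rotation \<alpha> = vector [vector [cos \<alpha>, - sin \<alpha>], vector [sin \<alpha>, cos \<alpha>]]"

definition input_vector :: "real^2" where
  "input_vector = vector [1, 0]"

definition critical_rate :: real where
  "critical_rate = (THE r. 0 < r \<and> r\<^sup>2 + r ^ 3 = 1)"

lemma critical_rate_unique: "\<exists>!r::real. 0 < r \<and> r\<^sup>2 + r ^ 3 = 1"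
proof -
  have "\<exists>r\<ge>0. r \<le> 1 \<and> r\<^sup>2 + r ^ 3 = (1::real)"
    by (rule IVT') (auto intro!: continuous_intros)
  then obtain r :: real where r: "0 \<le> r" "r\<^sup>2 + r ^ 3 = 1" by blast
  then have pos: "0 < r" by (cases "r = 0") auto
  have strict: "a\<^sup>2 + a ^ 3 < b\<^sup>2 + b ^ 3" if "0 < a" "a < b" for a b :: real
    using that by (intro add_strict_mono power_strict_mono) auto
  show ?thesis
  proof (rule ex1I[of _ r])
    fix s :: real assume s: "0 < s \<and> s\<^sup>2 + s ^ 3 = 1"
    then show "s = r" using strict[of s r] strict[of r s] r pos
      by (cases s r rule: linorder_cases) auto
  qed (use r pos in simp)
qed

lemma critical_rate:
  "0 < critical_rate" "critical_rate\<^sup>2 + critical_rate ^ 3 = 1"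
  using theI'[OF critical_rate_unique] by (simp_all add: critical_rate_def)

end

theory Submission
  imports Defs
begin

text \<open>
  Take \<open>2 cos \<alpha> = p + p\<^sup>2\<close>, where \<open>p\<close> is the critical rate.
  Under the two constant delays a linear controller yields two third-order linear systems. If both
  converge faster than \<open>p ^ t\<close>, then all roots of their characteristic polynomials lie in a smaller
  disk. The resulting Schur--Cohn inequalities at radius \<open>p\<close> are contradictory, since at this angle
  they are tight for the gain whose two cubics are \<open>(z - p) (z\<^sup>2 - p\<^sup>2 z + p\<^sup>2)\<close> and
  \<open>z (z\<^sup>2 - 2 cos \<alpha> z + p\<^sup>2)\<close>.

  A nonlinear controller can do better because it can detect from the measured state whether its
  last output has already been applied. Hence it can feed back the predicted state linearly, and
  the prediction then evolves by two planar linear maps with a common contracting polytope norm.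
\<close>

section \<open>Cubic polynomials with all roots in a disk\<close>

lemma real_cubic_has_root:
  fixes t m d :: real
  shows "\<exists>x. x ^ 3 - t * x\<^sup>2 + m * x - d = 0"
proof -
  \<comment> \<open>A Cauchy-type bound: \<open>N ^ 3\<close> splits into \<open>N\<^sup>2\<close>
    plus terms dominating those of lower degree, so the cubic is nonpositive at \<open>- N\<close>
    and nonnegative at \<open>N\<close>.\<close>
  define N where "N = 1 + \<bar>t\<bar> + \<bar>m\<bar> + \<bar>d\<bar>"
  have N1: "1 \<le> N" by (simp add: N_def)
  have N2: "N * 1 \<le> N * N" using N1 by (intro mult_left_mono) auto
  have tb: "\<bar>t * N\<^sup>2\<bar> = \<bar>t\<bar> * N\<^sup>2" by (simp add: abs_mult)
  have mb: "\<bar>m * N\<bar> \<le> \<bar>m\<bar> * N\<^sup>2"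
    using N1 N2 by (auto simp: abs_mult power2_eq_square intro!: mult_left_mono)
  have db: "\<bar>d\<bar> \<le> \<bar>d\<bar> * N\<^sup>2"
    using N1 by (simp add: mult_le_cancel_left1)
  have cube: "N ^ 3 = N\<^sup>2 + \<bar>t\<bar> * N\<^sup>2 + \<bar>m\<bar> * N\<^sup>2 + \<bar>d\<bar> * N\<^sup>2"
    unfolding power3_eq_cube power2_eq_square
    by (subst (1) N_def) (simp add: algebra_simps)
  have "\<exists>x\<ge>-N. x \<le> N \<and> x ^ 3 - t * x\<^sup>2 + m * x - d = 0"
  proof (rule IVT')
    have neg: "(- N) ^ 3 = - (N ^ 3)" by (simp add: power3_eq_cube)
    show "(- N) ^ 3 - t * (- N)\<^sup>2 + m * - N - d \<le> 0"
      unfolding neg using tb mb db cube by (smt (verit) mult_minus_right power2_minus zero_le_power2)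
    show "0 \<le> N ^ 3 - t * N\<^sup>2 + m * N - d"
      using tb mb db cube by (smt (verit) zero_le_power2)
  qed (use N1 in \<open>auto intro!: continuous_intros\<close>)
  then show ?thesis by blast
qed

text \<open>With roots x, a, b the three quantities are products over roots: d = x a b, the value at
  r is (r - x)(r - a)(r - b), and the last one is (r^2 - ab)(r^2 - xa)(r^2 - xb). Splitting off a
  real root x leaves a real quadratic with roots a, b, either both real or conjugate.\<close>

lemma cubic_roots_in_disk:
  fixes t m d r :: real
  assumes r: "0 < r"
    and roots: "\<And>z::complex. z ^ 3 - of_real t * z\<^sup>2 + of_real m * z - of_real d = 0 \<Longrightarrow> cmod z \<le> r"
  shows "\<bar>d\<bar> \<le> r ^ 3"
    and "0 \<le> r ^ 3 - t * r\<^sup>2 + m * r - d"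
    and "0 \<le> r ^ 6 - m * r ^ 4 + t * d * r\<^sup>2 - d\<^sup>2"
proof -
  have real_roots: "\<bar>y\<bar> \<le> r" if "y ^ 3 - t * y\<^sup>2 + m * y - d = 0" for y :: real
  proof -
    have "of_real (y ^ 3 - t * y\<^sup>2 + m * y - d) = (0::complex)" using that by simp
    then show ?thesis using roots[of "of_real y"] by simp
  qed
  obtain x where x: "x ^ 3 - t * x\<^sup>2 + m * x - d = 0" using real_cubic_has_root by blast
  have xr: "\<bar>x\<bar> \<le> r" using real_roots[OF x] .
  define u where "u = t - x"
  define v where "v = m - x * u"
  have t: "t = x + u" and m: "m = v + x * u" by (simp_all add: u_def v_def)
  have d: "d = x * v" using x unfolding t m by (simp add: power2_eq_square power3_eq_cube algebra_simps)
  have "\<bar>v\<bar> \<le> r\<^sup>2 \<and> 0 \<le> r\<^sup>2 - u * r + v \<and> 0 \<le> r ^ 4 - r\<^sup>2 * x * u + x\<^sup>2 * v"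
  proof (cases "u\<^sup>2 < 4 * v")
    case True
    define z where "z = Complex (u / 2) (sqrt (4 * v - u\<^sup>2) / 2)"
    have sq: "(sqrt (4 * v - u\<^sup>2))\<^sup>2 = 4 * v - u\<^sup>2" using True by simp
    have quad: "z\<^sup>2 - of_real u * z + of_real v = 0"
      using sq by (simp add: z_def complex_eq_iff power2_eq_square field_simps)
    have "z ^ 3 - of_real t * z\<^sup>2 + of_real m * z - of_real d
        = (z - of_real x) * (z\<^sup>2 - of_real u * z + of_real v)"
      unfolding t m d by (simp add: power2_eq_square power3_eq_cube algebra_simps)
    then have "cmod z \<le> r" using roots[of z] quad by simp
    then have "(cmod z)\<^sup>2 \<le> r\<^sup>2" by (intro power_mono) auto
    moreover have "(cmod z)\<^sup>2 = v"
      using sq by (simp add: z_def cmod_power2 power_divide field_simps)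
    moreover have "0 \<le> v" using True zero_le_power2[of u] by linarith
    \<comment> \<open>For a conjugate pair the products over its two roots are squared moduli,
      written here as sums of squares.\<close>
    moreover have "r\<^sup>2 - u * r + v = (r - u / 2)\<^sup>2 + (4 * v - u\<^sup>2) / 4"
      by (simp add: power2_eq_square field_simps)
    moreover have "r ^ 4 - r\<^sup>2 * x * u + x\<^sup>2 * v = (r\<^sup>2 - x * u / 2)\<^sup>2 + x\<^sup>2 * ((4 * v - u\<^sup>2) / 4)"
      by (simp add: power2_eq_square power4_eq_xxxx field_simps)
    ultimately show ?thesis using True by simp
  next
    case False
    define w where "w = sqrt (u\<^sup>2 - 4 * v)"
    have w: "w\<^sup>2 = u\<^sup>2 - 4 * v" using False by (simp add: w_def)
    define a where "a = (u + w) / 2"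
    define b where "b = (u - w) / 2"
    have u: "u = a + b" and v: "v = a * b"
      using w by (simp_all add: a_def b_def power2_eq_square field_simps)
    have ar: "\<bar>a\<bar> \<le> r" and br: "\<bar>b\<bar> \<le> r"
      by (rule real_roots, simp add: t m d u v power2_eq_square power3_eq_cube algebra_simps)+
    have "\<bar>v\<bar> \<le> r\<^sup>2" unfolding v abs_mult power2_eq_square
      using ar br r by (intro mult_mono) auto
    moreover have "r\<^sup>2 - u * r + v = (r - a) * (r - b)"
      unfolding u v by (simp add: power2_eq_square algebra_simps)
    moreover have "r ^ 4 - r\<^sup>2 * x * u + x\<^sup>2 * v = (r\<^sup>2 - x * a) * (r\<^sup>2 - x * b)"
      unfolding u v by (simp add: power2_eq_square power4_eq_xxxx algebra_simps)
    moreover have "x * a \<le> r\<^sup>2" "x * b \<le> r\<^sup>2"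
      using mult_mono[OF xr ar] mult_mono[OF xr br] r abs_le_D1[of "x * a"] abs_le_D1[of "x * b"]
      by (simp_all add: power2_eq_square abs_mult)
    ultimately show ?thesis using ar br by simp
  qed
  then have v: "\<bar>v\<bar> \<le> r\<^sup>2" "0 \<le> r\<^sup>2 - u * r + v" "0 \<le> r ^ 4 - r\<^sup>2 * x * u + x\<^sup>2 * v" by auto
  have "\<bar>x\<bar> * \<bar>v\<bar> \<le> r * r\<^sup>2" using xr v r by (intro mult_mono) auto
  then show "\<bar>d\<bar> \<le> r ^ 3" by (simp add: d abs_mult power2_eq_square power3_eq_cube)
  have "r ^ 3 - t * r\<^sup>2 + m * r - d = (r - x) * (r\<^sup>2 - u * r + v)"
    unfolding t m d by (simp add: power2_eq_square power3_eq_cube algebra_simps)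
  then show "0 \<le> r ^ 3 - t * r\<^sup>2 + m * r - d" using xr v by simp
  have "r ^ 6 - m * r ^ 4 + t * d * r\<^sup>2 - d\<^sup>2 = (r\<^sup>2 - v) * (r ^ 4 - r\<^sup>2 * x * u + x\<^sup>2 * v)"
    unfolding t m d by (simp add: eval_nat_numeral algebra_simps)
  then show "0 \<le> r ^ 6 - m * r ^ 4 + t * d * r\<^sup>2 - d\<^sup>2" using v by simp
qed

text \<open>
  The inequalities \<open>i1\<close>, \<open>i2\<close> are Schur--Cohn conditions for the characteristic polynomial of the
  closed loop under constant delay 1, and \<open>i3\<close> for constant delay 0, where the gain
  \<open>(k1, k2, g)\<close> enters through \<open>k adj(z - A) B = q1 z + q0\<close>.
\<close>
lemma critical_cubics_incompatible:
  fixes p c g q0 q1 :: real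
  assumes p: "0 < p" "p\<^sup>2 + p ^ 3 = 1" and c: "2 * c = p + p\<^sup>2"
    and g: "\<bar>g\<bar> \<le> p ^ 3" and Q: "g + q0 < p ^ 3"
    and i1: "0 \<le> p ^ 3 - (g + 2 * c) * p\<^sup>2 + (1 + 2 * c * g - q1) * p - (g + q0)"
    and i2: "0 \<le> p ^ 6 - (1 + 2 * c * g - q1) * p ^ 4 + (g + 2 * c) * (g + q0) * p\<^sup>2 - (g + q0)\<^sup>2"
    and i3: "0 \<le> p ^ 6 - (1 + 2 * c * g - q0) * p ^ 4 + (g + 2 * c + q1) * g * p\<^sup>2 - g\<^sup>2"
  shows False
proof -
  \<comment> \<open>\<open>e\<close> is the slack in the constant coefficient. The tight gain
    mentioned at the start corresponds to g = q1 = e = 0.\<close>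
  define e where "e = p ^ 3 - (g + q0)"
  have e: "0 < e" and q0: "q0 = p ^ 3 - e - g" using Q by (simp_all add: e_def)
  have C: "c = (p + p\<^sup>2) / 2" using c by simp
  have crit: "p\<^sup>2 + p ^ 3 - 1 = 0" using p(2) by simp
  have p1: "p < 1" using p by (smt (verit) one_le_power zero_less_power)
  \<comment> \<open>Modulo \<open>p\<^sup>2 + p ^ 3 = 1\<close>, each of the three expressions
    becomes a polynomial in g, q1, e without constant term, so all three vanish at the tight
    gain.\<close>
  have e1: "p ^ 3 - (g + 2 * c) * p\<^sup>2 + (1 + 2 * c * g - q1) * p - (g + q0) = p ^ 3 * g + e - p * q1"
  proof -
    have "p ^ 3 - (g + 2 * c) * p\<^sup>2 + (1 + 2 * c * g - q1) * p - (g + q0) - (p ^ 3 * g + e - p * q1)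
      = (- p) * (p\<^sup>2 + p ^ 3 - 1)"
      unfolding C q0 by (simp add: eval_nat_numeral field_simps)
    then show ?thesis unfolding crit by simp
  qed
  have e2: "p ^ 6 - (1 + 2 * c * g - q1) * p ^ 4 + (g + 2 * c) * (g + q0) * p\<^sup>2 - (g + q0)\<^sup>2
    = p ^ 4 * q1 - p ^ 6 * g + (p ^ 3 - p ^ 4) * e - p\<^sup>2 * g * e - e\<^sup>2"
  proof -
    have "p ^ 6 - (1 + 2 * c * g - q1) * p ^ 4 + (g + 2 * c) * (g + q0) * p\<^sup>2 - (g + q0)\<^sup>2
      - (p ^ 4 * q1 - p ^ 6 * g + (p ^ 3 - p ^ 4) * e - p\<^sup>2 * g * e - e\<^sup>2)
      = p ^ 4 * (p\<^sup>2 + p ^ 3 - 1)"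
      unfolding C q0 by (simp add: eval_nat_numeral field_simps)
    then show ?thesis unfolding crit by simp
  qed
  have e3: "p ^ 6 - (1 + 2 * c * g - q0) * p ^ 4 + (g + 2 * c + q1) * g * p\<^sup>2 - g\<^sup>2
    = p\<^sup>2 * g * q1 - (1 - p\<^sup>2) * g\<^sup>2 - p ^ 4 * e"
  proof -
    have "p ^ 6 - (1 + 2 * c * g - q0) * p ^ 4 + (g + 2 * c + q1) * g * p\<^sup>2 - g\<^sup>2
      - (p\<^sup>2 * g * q1 - (1 - p\<^sup>2) * g\<^sup>2 - p ^ 4 * e)
      = (p ^ 4 - p ^ 3 * g) * (p\<^sup>2 + p ^ 3 - 1)"
      unfolding C q0 by (simp add: eval_nat_numeral field_simps)
    then show ?thesis unfolding crit by simp
  qed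
  have pos: "0 < p\<^sup>2" "0 < p ^ 4" "0 < p ^ 3" using p by auto
  have p43: "p ^ 4 < p ^ 3" using p p1 by (intro power_strict_decreasing) auto
  have coef: "0 < 1 - p\<^sup>2 - p ^ 4" using p43 p by linarith
  have i3': "(1 - p\<^sup>2) * g\<^sup>2 + p ^ 4 * e \<le> p\<^sup>2 * g * q1" using i3 e3 by linarith
  show False
  \<comment> \<open>\<open>i3'\<close> bounds the product g q1 from below. For g nonnegative, q1 is
    eliminated by its upper bound from \<open>i1\<close>; for g negative, -q1 by its upper bound
    from \<open>i2\<close>.\<close>
  proof (cases "0 \<le> g")
    case True
    have "p * q1 \<le> p ^ 3 * g + e" using i1 e1 by linarith
    then have "(p * g) * (p * q1) \<le> (p * g) * (p ^ 3 * g + e)"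
      using p True by (intro mult_left_mono) auto
    then have "(1 - p\<^sup>2 - p ^ 4) * g\<^sup>2 + p * (p ^ 3 - g) * e \<le> 0"
      using i3' by (simp add: eval_nat_numeral algebra_simps)
    moreover have "0 \<le> (1 - p\<^sup>2 - p ^ 4) * g\<^sup>2" using coef by simp
    moreover have "0 \<le> p * (p ^ 3 - g) * e" using p g e by simp
    ultimately have "(1 - p\<^sup>2 - p ^ 4) * g\<^sup>2 = 0" by linarith
    then have "g = 0" using coef by simp
    then have "p ^ 4 * e \<le> 0" using i3' by simp
    then show False using mult_pos_pos[OF pos(2) e] by linarith
  next
    case False
    define h where "h = - g"
    have h: "0 < h" "h \<le> p ^ 3" "g = - h" using False g by (auto simp: h_def)
    have "p ^ 4 * - q1 \<le> p ^ 6 * h + (p ^ 3 - p ^ 4) * e + p\<^sup>2 * h * e - e\<^sup>2"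
      using i2 e2 h(3) by (simp add: algebra_simps)
    then have "h * (p ^ 4 * - q1) \<le> h * (p ^ 6 * h + (p ^ 3 - p ^ 4) * e + p\<^sup>2 * h * e - e\<^sup>2)"
      using h by (intro mult_left_mono) auto
    moreover have "p\<^sup>2 * ((1 - p\<^sup>2) * g\<^sup>2 + p ^ 4 * e) \<le> p\<^sup>2 * (p\<^sup>2 * g * q1)"
      using i3' by (intro mult_left_mono) auto
    ultimately have "p\<^sup>2 * ((1 - p\<^sup>2 - p ^ 4) * h\<^sup>2) + p\<^sup>2 * e * (p ^ 4 - (p - p\<^sup>2) * h - h\<^sup>2) + h * e\<^sup>2 \<le> 0"
      unfolding h(3) by (simp add: eval_nat_numeral algebra_simps)
    moreover have "0 < p\<^sup>2 * ((1 - p\<^sup>2 - p ^ 4) * h\<^sup>2)" using coef h pos by simp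
    \<comment> \<open>The expression decreases in h, and at the extreme value h = p^3 it equals p^5
      - p^6.\<close>
    moreover have "0 \<le> p ^ 4 - (p - p\<^sup>2) * h - h\<^sup>2"
    proof -
      have "p\<^sup>2 < p" using p p1 by (simp add: power2_eq_square)
      then have "(p - p\<^sup>2) * h \<le> (p - p\<^sup>2) * p ^ 3" using h by (intro mult_left_mono) auto
      moreover have "h\<^sup>2 \<le> (p ^ 3)\<^sup>2" using h by (intro power_mono) auto
      moreover have "(p ^ 3)\<^sup>2 \<le> p ^ 5" using p p1 by (simp flip: power_mult)
      ultimately show ?thesis by (simp add: eval_nat_numeral algebra_simps)
    qed
    then have "0 \<le> p\<^sup>2 * e * (p ^ 4 - (p - p\<^sup>2) * h - h\<^sup>2)" using e by simp
    moreover have "0 \<le> h * e\<^sup>2" using h by simp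
    ultimately show False by linarith
  qed
qed

section \<open>Linear controllers under constant delays\<close>

lemma applied_control_delay_01:
  assumes "switching_signal {0, 1} \<sigma>"
  shows "applied_control \<sigma> v t =
    (if \<sigma> t = 0 then v t else 0) + (if t \<noteq> 0 \<and> \<sigma> (t - 1) = 1 then v (t - 1) else 0)"
proof -
  have sig: "\<sigma> n = 0 \<or> \<sigma> n = 1" for n using assms by (auto simp: switching_signal_def)
  show ?thesis
  proof (cases t)
    \<comment> \<open>At time 0 nothing is pending. The guard \<open>t \<noteq> 0\<close> matters
      because truncated subtraction would make \<open>v 0\<close> its own predecessor.\<close>
    case 0
    then have "{t'. t' \<le> t \<and> t' + \<sigma> t' = t} = (if \<sigma> t = 0 then {t} else {})"
      by (auto intro!: gr0I)
    then show ?thesis using 0 by (simp add: applied_control_def)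
  next
    case (Suc n)
    have "{t'. t' \<le> t \<and> t' + \<sigma> t' = t}
      = (if \<sigma> t = 0 then {t} else {}) \<union> (if \<sigma> n = 1 then {n} else {})" (is "?L = ?R")
    proof
      show "?L \<subseteq> ?R"
      proof
        fix m assume "m \<in> ?L"
        then show "m \<in> ?R" using sig[of m] Suc by (cases "\<sigma> m = 0") auto
      qed
      show "?R \<subseteq> ?L" using Suc by auto
    qed
    then show ?thesis using Suc by (auto simp: applied_control_def)
  qed
qed

lemma planar_rotation_mult:
  "planar_rotation \<alpha> *v x =
    vector [cos \<alpha> * x $ 1 - sin \<alpha> * x $ 2, sin \<alpha> * x $ 1 + cos \<alpha> * x $ 2]"
  by (simp add: planar_rotation_def vec_eq_iff forall_2 matrix_vector_mult_def sum_2)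

lemma linear_controller_apply:
  "linear_controller G x w = G $ 1 $ 1 * x $ 1 + G $ 1 $ 2 * x $ 2 + G $ 1 $ 3 * w"
  by (simp add: linear_controller_def matrix_vector_mult_def sum_3)

lemma norm_le_sum_components: "norm (x :: real^2) \<le> \<bar>x $ 1\<bar> + \<bar>x $ 2\<bar>"
  using norm_le_l1_cart[of x] by (simp add: sum_2)

text \<open>\<open>w t\<close> is the control emitted at time \<open>t - 1\<close>.\<close>
definition constant_delay_run ::
  "real \<Rightarrow> (real \<Rightarrow> real \<Rightarrow> real \<Rightarrow> real) \<Rightarrow> bool \<Rightarrow> (nat \<Rightarrow> real) \<Rightarrow> (nat \<Rightarrow> real) \<Rightarrow> (nat \<Rightarrow> real) \<Rightarrow> bool" where
  "constant_delay_run \<alpha> F delayed a b w \<longleftrightarrow> w 0 = 0 \<and>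
     (\<forall>t. w (Suc t) = F (a t) (b t) (w t) \<and>
       a (Suc t) = cos \<alpha> * a t - sin \<alpha> * b t + (if delayed then w t else w (Suc t)) \<and>
       b (Suc t) = sin \<alpha> * a t + cos \<alpha> * b t)"

text \<open>Asking for one run loses nothing, since the initial state and \<open>F\<close> determine
  the run; it also supplies the trajectory together with its constant.\<close>

definition constant_delay_rate ::
  "real \<Rightarrow> (real \<Rightarrow> real \<Rightarrow> real \<Rightarrow> real) \<Rightarrow> real \<Rightarrow> bool" where
  "constant_delay_rate \<alpha> F r \<longleftrightarrow>
     (\<forall>delayed p q. \<exists>K a b w. constant_delay_run \<alpha> F delayed a b w \<and> a 0 = p \<and> b 0 = q \<and>
       (\<forall>t. \<bar>a t\<bar> \<le> K * r ^ t \<and> \<bar>b t\<bar> \<le> K * r ^ t))"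

lemma guarantees_rate_constant_delay:
  assumes "guarantees_rate (planar_rotation \<alpha>) input_vector {0, 1} f r"
  shows "constant_delay_rate \<alpha> (\<lambda>a b. f (vector [a, b])) r"
  unfolding constant_delay_rate_def
proof (intro allI)
  fix delayed :: bool and p q :: real
  \<comment> \<open>The run is built by iterating the closed loop on pairs of state and stored
    control.\<close>
  define step where "step = (\<lambda>(x :: real^2, w). let v = f x w in
    (planar_rotation \<alpha> *v x + (if delayed then w else v) *\<^sub>R input_vector, v))"
  define S where "S = (\<lambda>t. (step ^^ t) (vector [p, q], 0))"
  define x where "x = (\<lambda>t. fst (S t))"
  define w where "w = (\<lambda>t. snd (S t))"
  define v where "v = (\<lambda>t. w (Suc t))"
  define \<sigma> :: signal where "\<sigma> = (\<lambda>_. if delayed then 1 else 0)"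
  have S0: "x 0 = vector [p, q]" "w 0 = 0" by (simp_all add: x_def w_def S_def)
  have w: "w (Suc t) = f (x t) (w t)" for t
    by (simp add: x_def w_def S_def step_def Let_def case_prod_unfold)
  have x: "x (Suc t) = planar_rotation \<alpha> *v x t + (if delayed then w t else w (Suc t)) *\<^sub>R input_vector" for t
    by (simp add: x_def w_def S_def step_def Let_def case_prod_unfold)
  have \<sigma>: "switching_signal {0, 1} \<sigma>" by (simp add: switching_signal_def \<sigma>_def)
  have wv: "w t = (if t = 0 then 0 else v (t - 1))" for t
    by (cases t) (simp_all add: v_def S0)
  have applied: "applied_control \<sigma> v t = (if delayed then w t else w (Suc t))" for t
    unfolding applied_control_delay_01[OF \<sigma>] wv[of t] by (simp add: \<sigma>_def v_def)
  have "closed_loop (planar_rotation \<alpha>) input_vector f \<sigma> x v"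
    unfolding closed_loop_def applied wv[symmetric] using x w by (simp add: v_def)
  then obtain K where K: "norm (x t) \<le> K * r ^ t" for t
    using assms \<sigma> unfolding guarantees_rate_def by blast
  have comp: "vector [x t $ 1, x t $ 2] = x t" for t by (simp add: vec_eq_iff forall_2)
  have "constant_delay_run \<alpha> (\<lambda>a b. f (vector [a, b])) delayed (\<lambda>t. x t $ 1) (\<lambda>t. x t $ 2) w"
    unfolding constant_delay_run_def comp
    using S0 w x by (auto simp: planar_rotation_mult input_vector_def)
  moreover have "\<bar>x t $ i\<bar> \<le> K * r ^ t" for t i
    using component_le_norm_cart[of "x t" i] K[of t] by linarith
  ultimately show "\<exists>K a b w. constant_delay_run \<alpha> (\<lambda>a b. f (vector [a, b])) delayed a b w \<and> a 0 = p \<and> b 0 = q \<and>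
       (\<forall>t. \<bar>a t\<bar> \<le> K * r ^ t \<and> \<bar>b t\<bar> \<le> K * r ^ t)"
    using S0 by (intro exI[of _ K] exI[of _ "\<lambda>t. x t $ 1"] exI[of _ "\<lambda>t. x t $ 2"] exI[of _ w]) simp
qed

text \<open>Rates range over all reals; for a negative one the bound at time 1 is already
  negative.\<close>

lemma constant_delay_rate_nonneg:
  assumes "constant_delay_rate \<alpha> F r"
  shows "0 \<le> r"
proof (rule ccontr)
  assume "\<not> 0 \<le> r"
  obtain K a where a: "a 0 = (1::real)" "\<And>t. \<bar>a t\<bar> \<le> K * r ^ t"
    using assms unfolding constant_delay_rate_def by metis
  have "1 \<le> K" using a(1) a(2)[of 0] by simp
  then have "K * r < 0" using \<open>\<not> 0 \<le> r\<close> by (simp add: mult_pos_neg)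
  then show False using a(2)[of 1] by simp
qed

lemma constant_delay_rate_mono:
  assumes rate: "constant_delay_rate \<alpha> F r" and "r \<le> r'"
  shows "constant_delay_rate \<alpha> F r'"
  unfolding constant_delay_rate_def
proof (intro allI)
  fix delayed p q
  have r: "0 \<le> r" using rate by (rule constant_delay_rate_nonneg)
  obtain K a b w where run: "constant_delay_run \<alpha> F delayed a b w" "a 0 = p" "b 0 = q"
    and K: "\<And>t. \<bar>a t\<bar> \<le> K * r ^ t" "\<And>t. \<bar>b t\<bar> \<le> K * r ^ t"
    using rate unfolding constant_delay_rate_def by metis
  have "0 \<le> K" using K(1)[of 0] by simp
  then have "K * r ^ t \<le> K * r' ^ t" for t
    using r assms(2) by (intro mult_left_mono power_mono) auto
  then have "\<bar>a t\<bar> \<le> K * r' ^ t \<and> \<bar>b t\<bar> \<le> K * r' ^ t" for t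
    using K[of t] by (meson order_trans)
  then show "\<exists>K a b w. constant_delay_run \<alpha> F delayed a b w \<and> a 0 = p \<and> b 0 = q \<and>
       (\<forall>t. \<bar>a t\<bar> \<le> K * r' ^ t \<and> \<bar>b t\<bar> \<le> K * r' ^ t)"
    using run by blast
qed

section \<open>Decay rates as bounds on closed-loop eigenvalues\<close>

lemma geometric_growth_le:
  fixes l r C A :: real
  assumes "0 < A" "0 < r" and le: "\<And>t. A * l ^ t \<le> C * r ^ t"
  shows "l \<le> r"
proof (rule ccontr)
  assume "\<not> l \<le> r"
  then have "1 < l / r" using \<open>0 < r\<close> by simp
  then obtain t where "C / A < (l / r) ^ t" using real_arch_pow by blast
  then have "C * r ^ t < A * l ^ t"
    using assms(1,2) by (simp add: power_divide field_simps)
  then show False using le[of t] by simp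
qed

text \<open>The applied input is recovered from two consecutive states and hence decays like them.
  Without delay it is \<open>w (Suc t)\<close>, so the index shift costs a factor 1 / r.\<close>

lemma constant_delay_control_bounded:
  assumes run: "constant_delay_run \<alpha> F delayed a b w" and r: "0 < r"
    and K: "\<And>t. \<bar>a t\<bar> \<le> K * r ^ t" "\<And>t. \<bar>b t\<bar> \<le> K * r ^ t"
  shows "\<exists>M. \<forall>t. \<bar>w t\<bar> \<le> M * r ^ t"
proof -
  have u: "\<bar>if delayed then w t else w (Suc t)\<bar> \<le> (r + 2) * K * r ^ t" for t
  proof -
    have "(if delayed then w t else w (Suc t)) = a (Suc t) - cos \<alpha> * a t + sin \<alpha> * b t"
      using run by (simp add: constant_delay_run_def)
    moreover have "\<bar>cos \<alpha> * a t\<bar> \<le> 1 * (K * r ^ t)" "\<bar>sin \<alpha> * b t\<bar> \<le> 1 * (K * r ^ t)"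
      unfolding abs_mult using K[of t] by (intro mult_mono; simp)+
    ultimately have "\<bar>if delayed then w t else w (Suc t)\<bar> \<le> K * r ^ Suc t + K * r ^ t + K * r ^ t"
      using K(1)[of "Suc t"] by (smt (verit))
    then show ?thesis by (simp add: algebra_simps)
  qed
  show ?thesis
  proof (cases delayed)
    case True
    then show ?thesis using u by auto
  next
    case False
    have "0 \<le> K" using K(1)[of 0] by simp
    have "\<bar>w t\<bar> \<le> (r + 2) * K / r * r ^ t" for t
    proof (cases t)
      case 0
      then show ?thesis using run r \<open>0 \<le> K\<close> by (simp add: constant_delay_run_def)
    next
      case (Suc n)
      then show ?thesis using u[of n] False r by simp
    qed
    then show ?thesis by blast
  qed
qed

text \<open>
  The row vector \<open>k adj(z - A)\<close>, extended by a component for the stored control, is a left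
  eigenvector of the closed loop. It is nonzero on the initial states, where the stored control
  vanishes, because the rotation has no real eigenvector.
\<close>
lemma closed_loop_eigenvalue_bound:
  fixes k1 k2 g r \<alpha> :: real and z n l1 l2 :: complex
  assumes rate: "constant_delay_rate \<alpha> (\<lambda>a b w. k1 * a + k2 * b + g * w) r"
    and s: "sin \<alpha> \<noteq> 0" and k: "k1 \<noteq> 0 \<or> k2 \<noteq> 0" and r: "0 < r"
    and n: "n = z\<^sup>2 - 2 * cos \<alpha> * z + 1"
    and l: "l1 = k1 * (z - cos \<alpha>) + k2 * sin \<alpha>" "l2 = k2 * (z - cos \<alpha>) - k1 * sin \<alpha>"
    and root: "(z - g) * n = (if delayed then l1 else z * l1)"
  shows "cmod z \<le> r"
proof -
  \<comment> \<open>The component of the left eigenvector at the stored control. Without delay the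
    new control also enters the state at once, hence the correction by \<open>l1\<close>.\<close>
  define m where "m = (if delayed then n else n - l1)"
  have cs: "(cos \<alpha>)\<^sup>2 + (sin \<alpha>)\<^sup>2 = 1" by simp
  have "l1 \<noteq> 0 \<or> l2 \<noteq> 0"
  proof (rule ccontr)
    assume "\<not> ?thesis"
    then have "k2 * l1 - k1 * l2 = 0" by simp
    then have "of_real ((k1\<^sup>2 + k2\<^sup>2) * sin \<alpha>) = (0::complex)"
      unfolding l by (simp add: power2_eq_square algebra_simps)
    then have "k1\<^sup>2 + k2\<^sup>2 = 0" using s by (metis mult_eq_0_iff of_real_eq_0_iff)
    then show False using k by (simp add: sum_power2_eq_zero_iff)
  qed
  then obtain p q :: real where pq: "l1 * p + l2 * q \<noteq> 0"
    by (metis add.right_neutral add.left_neutral mult.right_neutral mult_zero_right of_real_0 of_real_1)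
  obtain K a b w where run: "constant_delay_run \<alpha> (\<lambda>a b w. k1 * a + k2 * b + g * w) delayed a b w"
    and init: "a 0 = p" "b 0 = q"
    and K: "\<And>t. \<bar>a t\<bar> \<le> K * r ^ t" "\<And>t. \<bar>b t\<bar> \<le> K * r ^ t"
    using rate unfolding constant_delay_rate_def by metis
  obtain M where M: "\<And>t. \<bar>w t\<bar> \<le> M * r ^ t"
    using constant_delay_control_bounded[OF run r K] by blast
  define L where "L = (\<lambda>t. l1 * a t + l2 * b t + m * w t)"
  have "L (Suc t) = z * L t" for t
  proof -
    define C S where "C = cos \<alpha>" and "S = sin \<alpha>"
    \<comment> \<open>The adjugate identity: \<open>(l1, l2)\<close> times z - A is \<open>n\<close>
      times \<open>(k1, k2)\<close>, where \<open>n\<close> is det (z - A).\<close>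
    have "l1 * (cos \<alpha> * a t - sin \<alpha> * b t) + l2 * (sin \<alpha> * a t + cos \<alpha> * b t)
        + n * (k1 * a t + k2 * b t) - z * (l1 * a t + l2 * b t)
      = of_real (1 - (cos \<alpha>)\<^sup>2 - (sin \<alpha>)\<^sup>2) * (k1 * a t + k2 * b t)"
      unfolding l n C_def[symmetric] S_def[symmetric] by (simp add: power2_eq_square algebra_simps)
    also have "1 - (cos \<alpha>)\<^sup>2 - (sin \<alpha>)\<^sup>2 = 0" using cs by linarith
    finally have adj: "l1 * (cos \<alpha> * a t - sin \<alpha> * b t) + l2 * (sin \<alpha> * a t + cos \<alpha> * b t)
      = z * (l1 * a t + l2 * b t) - n * (k1 * a t + k2 * b t)" by (simp add: algebra_simps)
    have w': "w (Suc t) = k1 * a t + k2 * b t + g * w t"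
      and a': "a (Suc t) = cos \<alpha> * a t - sin \<alpha> * b t + (if delayed then w t else w (Suc t))"
      and b': "b (Suc t) = sin \<alpha> * a t + cos \<alpha> * b t"
      using run by (simp_all add: constant_delay_run_def)
    have "L (Suc t) = (l1 * (cos \<alpha> * a t - sin \<alpha> * b t) + l2 * (sin \<alpha> * a t + cos \<alpha> * b t))
        + l1 * (if delayed then w t else w (Suc t)) + m * w (Suc t)"
      unfolding L_def a' b' by (cases delayed) (simp_all add: algebra_simps)
    also have "\<dots> = z * (l1 * a t + l2 * b t) + (n * g + (if delayed then l1 else 0)) * w t"
      unfolding adj m_def w' by (cases delayed) (simp_all add: algebra_simps)
    also have "n * g + (if delayed then l1 else 0) = z * m"
      using root by (cases delayed) (simp_all add: m_def algebra_simps)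
    finally show ?thesis by (simp add: L_def algebra_simps)
  qed
  moreover have "L 0 = l1 * p + l2 * q"
    using run by (simp add: L_def init constant_delay_run_def)
  ultimately have L: "L t = (l1 * p + l2 * q) * z ^ t" for t
    by (induction t) simp_all
  have "cmod (L t) \<le> (cmod l1 * K + cmod l2 * K + cmod m * M) * r ^ t" for t
  proof -
    have "cmod (L t) \<le> cmod l1 * \<bar>a t\<bar> + cmod l2 * \<bar>b t\<bar> + cmod m * \<bar>w t\<bar>"
      unfolding L_def by (intro norm_triangle_le add_mono) (simp_all add: norm_mult)
    also have "\<dots> \<le> cmod l1 * (K * r ^ t) + cmod l2 * (K * r ^ t) + cmod m * (M * r ^ t)"
      using K M by (intro add_mono mult_left_mono) auto
    finally show ?thesis by (simp add: algebra_simps)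
  qed
  then have "cmod (l1 * p + l2 * q) * cmod z ^ t \<le> (cmod l1 * K + cmod l2 * K + cmod m * M) * r ^ t" for t
    unfolding L norm_mult norm_power .
  from geometric_growth_le[OF _ r this] pq show ?thesis by simp
qed

text \<open>Without state feedback the stored control stays 0, so the state only rotates and keeps
  its norm.\<close>

lemma zero_gain_rate:
  assumes rate: "constant_delay_rate \<alpha> (\<lambda>a b w. g * w) r"
  shows "1 \<le> r\<^sup>2"
proof -
  obtain K a b w where run: "constant_delay_run \<alpha> (\<lambda>a b w. g * w) True a b w"
    and init: "a 0 = 1" "b 0 = 0"
    and K: "\<And>t. \<bar>a t\<bar> \<le> K * r ^ t" "\<And>t. \<bar>b t\<bar> \<le> K * r ^ t"
    using rate unfolding constant_delay_rate_def by metis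
  have w: "w t = 0" for t
    using run by (induction t) (simp_all add: constant_delay_run_def)
  have inv: "(a t)\<^sup>2 + (b t)\<^sup>2 = 1" for t
  proof (induction t)
    case (Suc t)
    define C S where "C = cos \<alpha>" and "S = sin \<alpha>"
    have a': "a (Suc t) = cos \<alpha> * a t - sin \<alpha> * b t" and b': "b (Suc t) = sin \<alpha> * a t + cos \<alpha> * b t"
      using run w by (simp_all add: constant_delay_run_def)
    have "(a (Suc t))\<^sup>2 + (b (Suc t))\<^sup>2 = ((cos \<alpha>)\<^sup>2 + (sin \<alpha>)\<^sup>2) * ((a t)\<^sup>2 + (b t)\<^sup>2)"
      unfolding a' b' C_def[symmetric] S_def[symmetric] by (simp add: power2_eq_square algebra_simps)
    then show ?case using Suc by simp
  qed (simp add: init)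
  have sq: "1 * 1 ^ t \<le> 2 * K\<^sup>2 * (r\<^sup>2) ^ t" for t
  proof -
    have "(a t)\<^sup>2 \<le> (K * r ^ t)\<^sup>2" "(b t)\<^sup>2 \<le> (K * r ^ t)\<^sup>2"
      using K by (metis abs_ge_zero power2_abs power_mono)+
    moreover have "(K * r ^ t)\<^sup>2 = K\<^sup>2 * (r\<^sup>2) ^ t"
      by (simp add: power_mult_distrib power_mult[symmetric] mult.commute)
    ultimately show ?thesis using inv[of t] by simp
  qed
  have "r \<noteq> 0" using sq[of 1] by auto
  then show ?thesis using geometric_growth_le[OF zero_less_one _ sq] by simp
qed

section \<open>The lower bound for linear controllers at the critical angle\<close>

lemma linear_controller_rate_lower_bound:
  assumes cos: "2 * cos \<alpha> = critical_rate + critical_rate\<^sup>2" and r: "r < critical_rate"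
  shows "\<not> guarantees_rate (planar_rotation \<alpha>) input_vector {0, 1} (linear_controller G) r"
proof
  let ?p = critical_rate and ?c = "cos \<alpha>" and ?s = "sin \<alpha>"
  assume "guarantees_rate (planar_rotation \<alpha>) input_vector {0, 1} (linear_controller G) r"
  then have rate0: "constant_delay_rate \<alpha> (\<lambda>a b. linear_controller G (vector [a, b])) r"
    by (rule guarantees_rate_constant_delay)
  define k1 where "k1 = G $ 1 $ 1"
  define k2 where "k2 = G $ 1 $ 2"
  define g where "g = G $ 1 $ 3"
  have p1: "?p < 1" using critical_rate by (smt (verit) one_le_power zero_less_power)
  have s: "?s \<noteq> 0"
  proof
    assume "?s = 0"
    then have "?c\<^sup>2 = 1" using sin_cos_squared_add[of \<alpha>] by simp
    moreover have "?p\<^sup>2 < ?p" using critical_rate p1 by (simp add: power2_eq_square)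
    ultimately show False using cos critical_rate(1) p1 power2_eq_1_iff[of ?c] zero_le_power2[of ?p] by linarith
  qed
  \<comment> \<open>The eigenvalue bound needs a positive radius, which \<open>r\<close> may fail to
    be; \<open>r'\<close> is positive and still below the critical rate.\<close>
  define r' where "r' = max r (?p / 2)"
  have r': "0 < r'" "r' < ?p" "r \<le> r'" using critical_rate(1) r by (auto simp: r'_def)
  have "(\<lambda>a b. linear_controller G (vector [a, b])) = (\<lambda>a b w. k1 * a + k2 * b + g * w)"
    by (simp add: fun_eq_iff linear_controller_apply k1_def k2_def g_def)
  then have rate: "constant_delay_rate \<alpha> (\<lambda>a b w. k1 * a + k2 * b + g * w) r'"
    using constant_delay_rate_mono[OF rate0 r'(3)] by simp
  have k: "k1 \<noteq> 0 \<or> k2 \<noteq> 0"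
  proof (rule ccontr)
    assume "\<not> ?thesis"
    then have "1 \<le> r'\<^sup>2" using rate zero_gain_rate[of \<alpha> g r'] by simp
    then show False using r' p1 using abs_square_less_1[of r'] by simp
  qed
  \<comment> \<open>Here k adj(z - A) B is \<open>k1 * z + q0\<close>, so \<open>k1\<close> takes
    the role of q1.\<close>
  define q0 where "q0 = k2 * ?s - k1 * ?c"
  have roots1: "cmod z \<le> r'"
    if "z ^ 3 - of_real (g + 2 * ?c) * z\<^sup>2 + of_real (1 + 2 * ?c * g - k1) * z - of_real (g + q0) = 0" for z :: complex
    by (rule closed_loop_eigenvalue_bound[OF rate s k r'(1) refl refl refl, where delayed = True])
      (use that in \<open>simp add: q0_def power2_eq_square power3_eq_cube algebra_simps\<close>)
  have roots0: "cmod z \<le> r'"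
    if "z ^ 3 - of_real (g + 2 * ?c + k1) * z\<^sup>2 + of_real (1 + 2 * ?c * g - q0) * z - of_real g = 0" for z :: complex
    by (rule closed_loop_eigenvalue_bound[OF rate s k r'(1) refl refl refl, where delayed = False])
      (use that in \<open>simp add: q0_def power2_eq_square power3_eq_cube algebra_simps\<close>)
  \<comment> \<open>The gap between \<open>r'\<close> and the critical rate is kept only here, to
    make the slack e positive; the other conditions are taken non-strictly at the critical
    rate.\<close>
  have "\<bar>g + q0\<bar> \<le> r' ^ 3" using cubic_roots_in_disk(1)[OF r'(1) roots1] .
  also have "\<dots> < ?p ^ 3" using r' by (intro power_strict_mono) auto
  finally have Q: "g + q0 < ?p ^ 3" by simp
  note roots1' = order_trans[OF roots1 less_imp_le[OF r'(2)]]
  note roots0' = order_trans[OF roots0 less_imp_le[OF r'(2)]]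
  show False
  proof (rule critical_cubics_incompatible[OF critical_rate cos _ Q])
    show "\<bar>g\<bar> \<le> ?p ^ 3"
      by (rule cubic_roots_in_disk(1)[OF critical_rate(1)], rule roots0')
    show "0 \<le> ?p ^ 3 - (g + 2 * ?c) * ?p\<^sup>2 + (1 + 2 * ?c * g - k1) * ?p - (g + q0)"
      by (rule cubic_roots_in_disk(2)[OF critical_rate(1)], rule roots1')
    show "0 \<le> ?p ^ 6 - (1 + 2 * ?c * g - k1) * ?p ^ 4 + (g + 2 * ?c) * (g + q0) * ?p\<^sup>2 - (g + q0)\<^sup>2"
      by (rule cubic_roots_in_disk(3)[OF critical_rate(1)], rule roots1')
    show "0 \<le> ?p ^ 6 - (1 + 2 * ?c * g - q0) * ?p ^ 4 + (g + 2 * ?c + k1) * g * ?p\<^sup>2 - g\<^sup>2"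
      by (rule cubic_roots_in_disk(3)[OF critical_rate(1)], rule roots0')
  qed
qed

section \<open>A nonlinear controller\<close>

lemma critical_rate_bounds: "0.7548 < critical_rate" "critical_rate < 0.7549"
proof -
  note p = critical_rate
  show "0.7548 < critical_rate"
  proof (rule ccontr)
    assume "\<not> ?thesis"
    then have "critical_rate\<^sup>2 \<le> 0.7548\<^sup>2" "critical_rate ^ 3 \<le> 0.7548 ^ 3"
      using p by (intro power_mono; simp)+
    then show False using p by (simp add: eval_nat_numeral)
  qed
  show "critical_rate < 0.7549"
  proof (rule ccontr)
    assume "\<not> ?thesis"
    then have "0.7549\<^sup>2 \<le> critical_rate\<^sup>2" "0.7549 ^ 3 \<le> critical_rate ^ 3"
      using p by (intro power_mono; simp)+
    then show False using p by (simp add: eval_nat_numeral)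
  qed
qed

lemma critical_angle:
  obtains \<alpha> where "2 * cos \<alpha> = critical_rate + critical_rate\<^sup>2"
    and "0.6622 \<le> cos \<alpha>" "cos \<alpha> \<le> 0.6624" "0.749 \<le> sin \<alpha>" "sin \<alpha> \<le> 0.7494"
proof -
  define c where "c = (critical_rate + critical_rate\<^sup>2) / 2"
  define \<alpha> where "\<alpha> = arccos c"
  have "0.7548\<^sup>2 \<le> critical_rate\<^sup>2" "critical_rate\<^sup>2 \<le> 0.7549\<^sup>2"
    using critical_rate_bounds critical_rate by (intro power_mono; simp)+
  then have c: "0.6622 \<le> c" "c \<le> 0.6624"
    using critical_rate_bounds by (simp_all add: c_def power2_eq_square)
  then have cos: "cos \<alpha> = c" by (simp add: \<alpha>_def cos_arccos)
  have "0.6622\<^sup>2 \<le> c\<^sup>2" "c\<^sup>2 \<le> 0.6624\<^sup>2" using c by (intro power_mono; simp)+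
  moreover have sin: "sin \<alpha> = sqrt (1 - c\<^sup>2)" using c by (simp add: \<alpha>_def sin_arccos)
  ultimately have "0.749 \<le> sin \<alpha>" "sin \<alpha> \<le> 0.7494"
    unfolding sin by (intro real_le_rsqrt real_le_lsqrt; simp add: power2_eq_square)+
  then show thesis using that[of \<alpha>] cos c by (simp add: c_def)
qed

text \<open>The coefficients are chosen so that both maps taking y to A (y + gain(y) B) and to A y +
  gain(y) B contract one common norm.\<close>

definition gain :: "real^2 \<Rightarrow> real" where
  "gain y = - 1.3 * y $ 1 - 0.35 * y $ 2"

text \<open>
  The controller feeds back the state \<open>A x + u B\<close> that it predicts in the absence of a new control,
  where \<open>u\<close> is the pending control. If \<open>w = gain y\<close> was emitted at the prediction \<open>y\<close>, then the
  measured state is \<open>y\<close> when \<open>w\<close> is still pending and \<open>y + w B\<close> otherwise, and in the latter case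
  its gain is \<open>- 0.3 * w\<close>. So the test \<open>gain x = w\<close> reveals the delay (for \<open>w = 0\<close> nothing is pending either way).
\<close>
definition predictive_controller :: "real \<Rightarrow> controller" where
  "predictive_controller \<alpha> x w =
     gain (planar_rotation \<alpha> *v x + (if gain x = w then w else 0) *\<^sub>R input_vector)"

text \<open>The unit ball is a parallelogram, so contraction by a linear map reduces to estimates
  for two linear functionals.\<close>

definition polytope_norm :: "real^2 \<Rightarrow> real" where
  "polytope_norm y = max (6 * \<bar>y $ 1 + y $ 2\<bar>) \<bar>y $ 1 - 4 * y $ 2\<bar>"

lemma functional_le_polytope_norm:
  "\<bar>A * y $ 1 + B * y $ 2\<bar> \<le> (\<bar>4 * A + B\<bar> / 30 + \<bar>A - B\<bar> / 5) * polytope_norm y"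
proof -
  let ?P = "y $ 1 + y $ 2" and ?Q = "y $ 1 - 4 * y $ 2"
  \<comment> \<open>Expansion in the dual basis formed by the two functionals defining the
    norm.\<close>
  have "A * y $ 1 + B * y $ 2 = (4 * A + B) / 5 * ?P + (A - B) / 5 * ?Q"
    by (simp add: field_simps)
  then have "\<bar>A * y $ 1 + B * y $ 2\<bar> \<le> \<bar>4 * A + B\<bar> / 5 * \<bar>?P\<bar> + \<bar>A - B\<bar> / 5 * \<bar>?Q\<bar>"
    using abs_triangle_ineq[of "(4 * A + B) / 5 * ?P" "(A - B) / 5 * ?Q"] by (simp add: abs_mult)
  also have "\<dots> \<le> \<bar>4 * A + B\<bar> / 5 * (polytope_norm y / 6) + \<bar>A - B\<bar> / 5 * polytope_norm y"
    by (intro add_mono mult_left_mono) (auto simp: polytope_norm_def)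
  finally show ?thesis by (simp add: algebra_simps)
qed

lemma norm_le_polytope_norm: "norm y \<le> polytope_norm y"
proof -
  have "\<bar>y $ 1\<bar> \<le> 1 / 3 * polytope_norm y" "\<bar>y $ 2\<bar> \<le> 7 / 30 * polytope_norm y"
    using functional_le_polytope_norm[of 1 y 0] functional_le_polytope_norm[of 0 y 1] by simp_all
  moreover have "0 \<le> polytope_norm y" by (simp add: polytope_norm_def)
  ultimately show ?thesis using norm_le_sum_components[of y] by linarith
qed

text \<open>\<open>a\<close>, \<open>b\<close> and \<open>a'\<close>, \<open>b'\<close> bound five
  times the coordinates, in that dual basis, of the two functionals pulled back along the map. The
  hypotheses on \<open>r\<close> are the weighted row sums.\<close>

lemma polytope_norm_linear_image:
  assumes z: "z $ 1 = A1 * y $ 1 + B1 * y $ 2" "z $ 2 = A2 * y $ 1 + B2 * y $ 2"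
    and P: "\<bar>4 * (A1 + A2) + (B1 + B2)\<bar> \<le> a" "\<bar>(A1 + A2) - (B1 + B2)\<bar> \<le> b" "a / 5 + 6 * b / 5 \<le> r"
    and Q: "\<bar>4 * (A1 - 4 * A2) + (B1 - 4 * B2)\<bar> \<le> a'" "\<bar>(A1 - 4 * A2) - (B1 - 4 * B2)\<bar> \<le> b'"
      "a' / 30 + b' / 5 \<le> r"
  shows "polytope_norm z \<le> r * polytope_norm y"
proof -
  let ?V = "polytope_norm y"
  have V: "0 \<le> ?V" by (simp add: polytope_norm_def)
  have bound: "\<bar>A * y $ 1 + B * y $ 2\<bar> \<le> (p / 30 + q / 5) * ?V"
    if "\<bar>4 * A + B\<bar> \<le> p" "\<bar>A - B\<bar> \<le> q" for A B p q
  proof -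
    have "\<bar>4 * A + B\<bar> / 30 + \<bar>A - B\<bar> / 5 \<le> p / 30 + q / 5"
      using that by (intro add_mono divide_right_mono) auto
    from order_trans[OF functional_le_polytope_norm mult_right_mono[OF this V]] show ?thesis .
  qed
  have "z $ 1 + z $ 2 = (A1 + A2) * y $ 1 + (B1 + B2) * y $ 2"
    "z $ 1 - 4 * z $ 2 = (A1 - 4 * A2) * y $ 1 + (B1 - 4 * B2) * y $ 2"
    unfolding z by (simp_all add: algebra_simps)
  then have "\<bar>z $ 1 + z $ 2\<bar> \<le> (a / 30 + b / 5) * ?V" "\<bar>z $ 1 - 4 * z $ 2\<bar> \<le> (a' / 30 + b' / 5) * ?V"
    using bound[OF P(1,2)] bound[OF Q(1,2)] by simp_all
  then have P': "6 * \<bar>z $ 1 + z $ 2\<bar> \<le> 6 * ((a / 30 + b / 5) * ?V)"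
    and Q': "\<bar>z $ 1 - 4 * z $ 2\<bar> \<le> (a' / 30 + b' / 5) * ?V" by (auto intro: mult_left_mono)
  have "6 * ((a / 30 + b / 5) * ?V) = (a / 5 + 6 * b / 5) * ?V" by (simp add: field_simps)
  with P' have "6 * \<bar>z $ 1 + z $ 2\<bar> \<le> r * ?V"
    using mult_right_mono[OF P(3) V] by (metis order_trans)
  moreover have "\<bar>z $ 1 - 4 * z $ 2\<bar> \<le> r * ?V"
    using Q' mult_right_mono[OF Q(3) V] by (rule order_trans)
  ultimately show ?thesis unfolding polytope_norm_def[of z] by (rule max.boundedI)
qed

lemma polytope_norm_contraction:
  assumes c: "0.6622 \<le> cos \<alpha>" "cos \<alpha> \<le> 0.6624" and s: "0.749 \<le> sin \<alpha>" "sin \<alpha> \<le> 0.7494"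
  shows "polytope_norm (planar_rotation \<alpha> *v (y + gain y *\<^sub>R input_vector)) \<le> 0.69 * polytope_norm y"
    and "polytope_norm (planar_rotation \<alpha> *v y + gain y *\<^sub>R input_vector) \<le> 0.69 * polytope_norm y"
proof -
  note components = planar_rotation_mult input_vector_def gain_def algebra_simps
  show "polytope_norm (planar_rotation \<alpha> *v (y + gain y *\<^sub>R input_vector)) \<le> 0.69 * polytope_norm y"
    \<comment> \<open>The first four terms are the matrix entries; the decimals round up the
      required bounds over the angle enclosure. Here and in the second case the row sums stay below
      0.67.\<close>
    by (rule polytope_norm_linear_image[of _ "- 0.3 * cos \<alpha>" _ "- 0.35 * cos \<alpha> - sin \<alpha>"
          "- 0.3 * sin \<alpha>" "cos \<alpha> - 0.35 * sin \<alpha>" "2.28" "0.16" _ "0.23" "3.29"];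
        (use c s in \<open>simp add: components abs_le_iff\<close>)?)
  show "polytope_norm (planar_rotation \<alpha> *v y + gain y *\<^sub>R input_vector) \<le> 0.69 * polytope_norm y"
    by (rule polytope_norm_linear_image[of _ "cos \<alpha> - 1.3" _ "- sin \<alpha> - 0.35" "sin \<alpha>" "cos \<alpha>"
          "0.03" "0.549" _ "18.3" "0.12"];
        (use c s in \<open>simp add: components abs_le_iff\<close>)?)
qed

text \<open>Once the control is known to be the gain at the prediction, the signal merely selects
  which of the two contractions moves the prediction. The state differs from the preceding
  prediction by at most one control.\<close>

lemma predictive_controller_rate:
  assumes c: "0.6622 \<le> cos \<alpha>" "cos \<alpha> \<le> 0.6624" and s: "0.749 \<le> sin \<alpha>" "sin \<alpha> \<le> 0.7494"
  shows "guarantees_rate (planar_rotation \<alpha>) input_vector {0, 1} (predictive_controller \<alpha>) 0.69"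
  unfolding guarantees_rate_def
proof (intro allI exI impI)
  fix x0 :: "real^2" and \<sigma> x v t
  let ?A = "planar_rotation \<alpha>" and ?B = input_vector and ?V = polytope_norm
  assume \<sigma>: "switching_signal {0, 1} \<sigma>"
    and loop: "closed_loop ?A ?B (predictive_controller \<alpha>) \<sigma> x v" and x0: "x 0 = x0"
  have sig: "\<sigma> n = 0 \<or> \<sigma> n = 1" for n using \<sigma> by (auto simp: switching_signal_def)
  define pending where "pending = (\<lambda>t. if t \<noteq> 0 \<and> \<sigma> (t - 1) = 1 then v (t - 1) else 0)"
  define y where "y = (\<lambda>t. ?A *v x t + pending t *\<^sub>R ?B)"
  have y: "y t = ?A *v x t + pending t *\<^sub>R ?B" for t by (simp add: y_def)
  have x: "x (Suc t) = y t + (if \<sigma> t = 0 then v t else 0) *\<^sub>R ?B" for t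
    using loop applied_control_delay_01[OF \<sigma>, of v t]
    by (simp add: closed_loop_def y_def pending_def scaleR_add_left)
  have pend: "pending (Suc t) = (if \<sigma> t = 1 then v t else 0)" for t by (simp add: pending_def)
  have ctrl: "v t = predictive_controller \<alpha> (x t) (if t = 0 then 0 else v (t - 1))" for t
    using loop by (simp add: closed_loop_def)
  have v: "v t = gain (y t)" for t
  proof (induction t)
    case 0
    then show ?case using ctrl[of 0] by (simp add: predictive_controller_def y_def pending_def)
  next
    case (Suc t)
    \<comment> \<open>By the induction hypothesis \<open>v t\<close> is the gain at
      \<open>y t\<close>, which is what lets the test recover the pending control.\<close>
    have "(if gain (x (Suc t)) = v t then v t else 0) = pending (Suc t)"
      using sig[of t] Suc by (auto simp: pend x gain_def input_vector_def algebra_simps)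
    then show ?case using ctrl[of "Suc t"] by (simp add: predictive_controller_def y_def)
  qed
  have step: "?V (y (Suc t)) \<le> 0.69 * ?V (y t)" for t
    using sig[of t]
  proof
    assume "\<sigma> t = 0"
    then have "y (Suc t) = ?A *v (y t + gain (y t) *\<^sub>R ?B)" by (simp add: y[of "Suc t"] x pend v)
    then show ?thesis using polytope_norm_contraction(1)[OF c s] by simp
  next
    assume "\<sigma> t = 1"
    then have "y (Suc t) = ?A *v y t + gain (y t) *\<^sub>R ?B" by (simp add: y[of "Suc t"] x pend v)
    then show ?thesis using polytope_norm_contraction(2)[OF c s] by simp
  qed
  have V: "?V (y t) \<le> ?V (?A *v x0) * 0.69 ^ t" for t
  proof (induction t)
    case 0
    then show ?case by (simp add: y_def pending_def x0)
  next
    case (Suc t)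
    then show ?case using step[of t] by simp
  qed
  have V0: "0 \<le> ?V z" for z by (simp add: polytope_norm_def)
  \<comment> \<open>\<open>norm x0\<close> covers time 0. The factor 3 is 1 for the prediction plus
    2 for the control; division by 0.69 compensates for bounding the state by the prediction one
    step earlier.\<close>
  show "norm (x t) \<le> (norm x0 + 3 * ?V (?A *v x0) / 0.69) * 0.69 ^ t"
  proof (cases t)
    case 0
    then show ?thesis using V0[of "?A *v x0"] by (simp add: x0)
  next
    case (Suc n)
    have B: "norm ?B \<le> 1" using norm_le_sum_components[of ?B] by (simp add: input_vector_def)
    have "\<bar>v n\<bar> \<le> (\<bar>4 * - 1.3 + - 0.35\<bar> / 30 + \<bar>- 1.3 - - 0.35\<bar> / 5) * ?V (y n)"
      using functional_le_polytope_norm[of "- 1.3" "y n" "- 0.35"] by (simp add: v gain_def)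
    then have "\<bar>v n\<bar> \<le> 2 * ?V (y n)" using V0[of "y n"] by simp
    moreover have "norm ((if \<sigma> n = 0 then v n else 0) *\<^sub>R ?B) \<le> \<bar>v n\<bar> * 1"
      using B by (auto simp: mult_left_le)
    ultimately have "norm (x (Suc n)) \<le> 3 * ?V (y n)"
      unfolding x using norm_triangle_ineq[of "y n" "(if \<sigma> n = 0 then v n else 0) *\<^sub>R ?B"]
        norm_le_polytope_norm[of "y n"] by linarith
    also have "\<dots> \<le> 3 * ?V (?A *v x0) / 0.69 * 0.69 ^ t" using V[of n] Suc by simp
    also have "\<dots> \<le> (norm x0 + 3 * ?V (?A *v x0) / 0.69) * 0.69 ^ t" by (intro mult_right_mono) auto
    finally show ?thesis using Suc by simp
  qed
qed

theorem theorem7: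
  shows "\<exists>\<alpha>.
    (\<forall>G. \<forall>\<rho><critical_rate.
       \<not> guarantees_rate (planar_rotation \<alpha>) input_vector {0, 1} (linear_controller G) \<rho>) \<and>
    (\<exists>f. \<exists>\<rho>. 0.69 \<le> \<rho> \<and> \<rho> < 0.70 \<and>
       guarantees_rate (planar_rotation \<alpha>) input_vector {0, 1} f \<rho>)"
proof -
  obtain \<alpha> where cos: "2 * cos \<alpha> = critical_rate + critical_rate\<^sup>2"
    and "0.6622 \<le> cos \<alpha>" "cos \<alpha> \<le> 0.6624" "0.749 \<le> sin \<alpha>" "sin \<alpha> \<le> 0.7494"
    by (rule critical_angle)
  then have "guarantees_rate (planar_rotation \<alpha>) input_vector {0, 1} (predictive_controller \<alpha>) 0.69"
    by (intro predictive_controller_rate)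
  moreover have "(0.69::real) \<le> 0.69" "(0.69::real) < 0.70" by simp_all
  ultimately show ?thesis using linear_controller_rate_lower_bound[OF cos] by blast
qed

end
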